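(* Let $F$, $f$, $(\xi_k)_{k\in\mathbb N}$, $G$, $H$ be as in the context, and suppose that (A1), (A2), (A3) hold. Fix $w_1\in\mathbb R^d$. For each $K\in\mathbb N$ let $w_1=w_1^{(K)},w_2^{(K)},\dots,w_{K+1}^{(K)}$ be the iterates of the method started at $w_1$ with the constant step size $\alpha_k=\frac1{\sqrt K}$, $k=1,\dots,K$, where $K$ is the total number of iterations. Suppose that there is $w_*\in\arg\min_{w\in\mathbb R^d}F(w)$ which satisfies (A4) or (A5), and which satisfies the moment bound (A6) with a constant $M$ not depending on $K$. Then $$\min_{1\le k\le K}\mathbb E\big[\|\nabla F(w_k^{(K)})\|^2\big]=\mathcal O\Big(\frac1{\sqrt K}\Big),$$ that is, there is a constant $C$ independent of $K$ such that the left-hand side is at most $C/\sqrt K$ for all $K\in\mathbb N$.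
   Context: Notation: $\|\cdot\|$ is the Euclidean norm on $\mathbb R^d$, $d\in\mathbb N$; $\mathbb N=\{1,2,\dots\}$; $\mathbb R^+$ denotes the positive reals and $\mathbb R^+_0$ the non-negative reals. $(\Omega,\mathcal F,\mathbb P)$ is a complete probability space; $(\xi_k)_{k\in\mathbb N}$ is a sequence of independent, identically distributed random variables on $\Omega$, and $\xi$ denotes a random variable with their common distribution. The objective function is $F:\mathbb R^d\to\mathbb R$, $F(w)=\mathbb E[f(w,\xi)]$. Method: given functions $G,H:\mathbb R^d\times\mathbb R^+\to\mathbb R^d$ with $G(x,\alpha)=x-\alpha H(x,\alpha)$, step sizes $\alpha_k\in\mathbb R^+$ and a (deterministic) initial value $w_1\in\mathbb R^d$, the iterates are generated by $$w_{k+1}=w_k-\alpha_kG(\nabla f(w_k,\xi_k),\alpha_k)=w_k-\alpha_k\nabla f(w_k,\xi_k)+\alpha_k^2H(\nabla f(w_k,\xi_k),\alpha_k).$$ Assumptions: (A1) There are constants $c_g\in\mathbb R^+$ and $c_h\in\mathbb R^+_0$ such that $\|G(x,\alpha)\|\le c_g\|x\|$ and $\|H(x,\alpha)\|\le c_h\|x\|^2$ for all $x\in\mathbb R^d$, $\alpha\in\mathbb R^+$. (A2) (Unbiased gradients) The stochastic gradient $\nabla f(\cdot,\xi)$ satisfies $\mathbb E[\nabla f(v,\xi)]=\nabla F(v)$ for all $v\in\mathbb R^d$. (A3) (Lipschitz gradients) $F$ is continuously differentiable and $\|\nabla F(v)-\nabla F(w)\|\le L\|v-w\|$ for all $v,w\in\mathbb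 R^d$, with $L\in\mathbb R^+$. Moreover there is a $\sigma(\xi)$-measurable, square-integrable random variable $L_\xi$ with values in $\mathbb R^+$ such that almost surely $\|\nabla f(v,\xi)-\nabla f(w,\xi)\|\le L_\xi\|v-w\|$ for all $v,w\in\mathbb R^d$, and $\mathbb E[L_\xi^2]\le L^2$. (A4) (Bounded variance, for $w_*\in\arg\min F$) $\mathbb E[\|\nabla f(w_*,\xi)\|^2]\le\sigma^2$ for some finite $\sigma^2$. (A5) (Interpolation, for $w_*\in\arg\min F$) almost surely $w_*\in\arg\min_{w\in\mathbb R^d}f(w,\xi)$; in particular $\nabla f(w_*,\xi)=0$ almost surely. (A6) (Moment bound, for $w_*$) there is $M\in\mathbb R^+$ with $\mathbb E[\|w_k^{(K)}-w_*\|^3]\le M$ for all $K\in\mathbb N$ and all iterates $w_k^{(K)}$, $1\le k\le K+1$. *)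

theory Defs
  imports "HOL-Probability.Probability"
begin

definition grad :: "('v::real_inner \<Rightarrow> real) \<Rightarrow> 'v \<Rightarrow> 'v"
  where "grad f x = (THE D. GDERIV f x :> D)"

lemma grad_eqI:
  assumes "GDERIV f x :> D"
  shows "grad f x = D"
  unfolding grad_def
proof (rule the_equality[where P = "\<lambda>D. GDERIV f x :> D", OF assms])
  fix D' assume "GDERIV f x :> D'"
  with assms have "(\<lambda>h. h \<bullet> D') = (\<lambda>h. h \<bullet> D)"
    unfolding gderiv_def by (metis has_derivative_unique)
  then have "h \<bullet> D' = h \<bullet> D" for h
    by (rule fun_cong)
  then show "D' = D"
    using vector_eq_ldot[of D' D] by blast
qed

lemma GDERIV_grad:
  fixes f :: "'v::euclidean_space \<Rightarrow> real"
  assumes "f differentiable (at x)"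
  shows "GDERIV f x :> grad f x"
proof -
  from assms obtain f' where f': "(f has_derivative f') (at x)"
    unfolding differentiable_def by blast
  then have "f' = (\<lambda>h. h \<bullet> adjoint f' 1)"
    using adjoint_works[OF has_derivative_linear[OF f'], of _ 1] by (auto simp: fun_eq_iff)
  with f' have "GDERIV f x :> adjoint f' 1"
    unfolding gderiv_def by metis
  then show ?thesis
    by (simp add: grad_eqI)
qed

text \<open>
  A run of \<open>K\<close> steps with step sizes \<open>\<alpha> 1, \<dots>, \<alpha> K\<close>: both the data \<open>X k\<close> and the iterates
  \<open>w k\<close> are indexed from \<open>1\<close>, the last iterate being \<open>w (K + 1)\<close>; other values of \<open>w\<close> are
  unconstrained. The gradient of \<open>f\<close> is taken in the first argument only.
\<close>

definition sgd_iterates ::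
    "'a measure \<Rightarrow> ('v::real_inner \<Rightarrow> 's \<Rightarrow> real) \<Rightarrow> ('v \<Rightarrow> real \<Rightarrow> 'v) \<Rightarrow> (nat \<Rightarrow> 'a \<Rightarrow> 's) \<Rightarrow>
     (nat \<Rightarrow> real) \<Rightarrow> nat \<Rightarrow> 'v \<Rightarrow> (nat \<Rightarrow> 'a \<Rightarrow> 'v) \<Rightarrow> bool"
  where "sgd_iterates M f G X \<alpha> K w\<^sub>1 w \<longleftrightarrow>
    (\<forall>\<omega>\<in>space M. w 1 \<omega> = w\<^sub>1) \<and>
    (\<forall>k\<in>{1..K}. \<forall>\<omega>\<in>space M.
       w (k + 1) \<omega> = w k \<omega> - \<alpha> k *\<^sub>R G (grad (\<lambda>v. f v (X k \<omega>)) (w k \<omega>)) (\<alpha> k))"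

end

theory Submission
  imports Defs
begin

text \<open>
  Each iterate \<open>w k\<close> is a measurable function of \<open>X 1, \<dots>, X (k - 1)\<close>, hence independent of \<open>X k\<close>, so
  one-step expectations can be computed by Fubini with the iterate frozen at a point \<open>v\<close>. There
  \<open>L\<close>-smoothness of \<open>F\<close> gives a descent of \<open>\<alpha> * (norm (grad F v))\<^sup>2\<close> up to an error
  \<open>\<alpha>\<^sup>2 * (c\<^sub>h * norm (grad F v) + L / 2 * c\<^sub>g\<^sup>2)\<close> times the second moment of the stochastic gradient.
  With \<open>r = norm (v - w_star)\<close> the gradient norm is at most \<open>L * r\<close> and the second moment at most
  \<open>2 * L\<^sup>2 * r\<^sup>2 + 2 * \<sigma>\<^sup>2\<close>, so the error is cubic in \<open>r\<close>, which is what the third moment bound controls.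
  Summing over the \<open>K\<close> steps, the accumulated error \<open>K * \<alpha>\<^sup>2\<close> is constant for \<open>\<alpha> = 1 / sqrt K\<close>.
\<close>

section \<open>Joint measurability of the stochastic gradient\<close>

text \<open>Replacing the point \<open>v\<close> by simple functions \<open>\<phi> n\<close>
  converging to it leaves only finitely many sections \<open>f v\<close> to glue at each stage, and
  continuity in \<open>v\<close> carries measurability to the limit.\<close>

lemma caratheodory_measurable:
  fixes f :: "'v::{metric_space, second_countable_topology} \<Rightarrow> 's \<Rightarrow> 'b::metric_space"
  assumes meas: "\<And>v. f v \<in> borel_measurable S"
    and cont: "\<And>s. s \<in> space S \<Longrightarrow> continuous_on UNIV (\<lambda>v. f v s)"
  shows "(\<lambda>p. f (fst p) (snd p)) \<in> borel_measurable (borel \<Otimes>\<^sub>M S)"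
proof -
  obtain \<phi> :: "nat \<Rightarrow> 'v \<Rightarrow> 'v" where \<phi>: "\<And>n. simple_function borel (\<phi> n)"
    and lim: "\<And>v. (\<lambda>n. \<phi> n v) \<longlonglongrightarrow> v"
    using borel_measurable_implies_sequence_metric[of "\<lambda>v::'v. v" borel undefined]
    by auto
  show ?thesis
  proof (rule borel_measurable_LIMSEQ_metric)
    fix n
    have fin: "finite (range (\<phi> n))"
      using \<phi>[of n] by (simp add: simple_function_def)
    have "\<phi> n \<in> borel \<rightarrow>\<^sub>M count_space (range (\<phi> n))"
      using \<phi>[of n] fin by (auto simp: measurable_count_space_eq2 simple_function_def)
    then have "(\<lambda>p. \<phi> n (fst p)) \<in> borel \<Otimes>\<^sub>M S \<rightarrow>\<^sub>M count_space (range (\<phi> n))"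
      by (rule measurable_compose[OF measurable_fst])
    then show "(\<lambda>p. f (\<phi> n (fst p)) (snd p)) \<in> borel_measurable (borel \<Otimes>\<^sub>M S)"
      by (rule measurable_compose_countable'[rotated])
        (use fin meas in \<open>auto intro: countable_finite\<close>)
  next
    fix p :: "'v \<times> 's" assume "p \<in> space (borel \<Otimes>\<^sub>M S)"
    then have "isCont (\<lambda>v. f v (snd p)) (fst p)"
      using cont by (auto simp: space_pair_measure continuous_on_eq_continuous_at)
    then show "(\<lambda>n. f (\<phi> n (fst p)) (snd p)) \<longlonglongrightarrow> f (fst p) (snd p)"
      using lim isCont_tendsto_compose by blast
  qed
qed

lemma has_real_derivative_along_line:
  fixes f :: "'v::euclidean_space \<Rightarrow> real"
  assumes "f differentiable (at (x + t *\<^sub>R d))"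
  shows "((\<lambda>t. f (x + t *\<^sub>R d)) has_real_derivative (grad f (x + t *\<^sub>R d) \<bullet> d)) (at t)"
proof -
  have "(f has_derivative (\<lambda>h. h \<bullet> grad f (x + t *\<^sub>R d))) (at (x + t *\<^sub>R d))"
    using GDERIV_grad[OF assms] by (simp add: gderiv_def)
  then have "((\<lambda>t. f (x + t *\<^sub>R d)) has_derivative (\<lambda>s. (s *\<^sub>R d) \<bullet> grad f (x + t *\<^sub>R d))) (at t)"
    by (intro has_derivative_compose[where g = f and f = "\<lambda>t. x + t *\<^sub>R d"])
      (auto intro!: derivative_eq_intros)
  moreover have "(\<lambda>s. (s *\<^sub>R d) \<bullet> grad f (x + t *\<^sub>R d)) = (*) (grad f (x + t *\<^sub>R d) \<bullet> d)"
    by (auto simp: inner_commute)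
  ultimately show ?thesis
    by (simp add: has_field_derivative_def)
qed

text \<open>Restricting the difference quotient to the steps \<open>1 / (n + 1)\<close> turns a
  directional derivative into a limit of a sequence, through which measurability passes.\<close>

lemma grad_inner_LIMSEQ:
  fixes f :: "'v::euclidean_space \<Rightarrow> real"
  assumes "f differentiable (at x)"
  shows "(\<lambda>n. (f (x + inverse (real (Suc n)) *\<^sub>R b) - f x) / inverse (real (Suc n)))
    \<longlonglongrightarrow> grad f x \<bullet> b"
proof -
  have "((\<lambda>t. f (x + t *\<^sub>R b)) has_real_derivative (grad f x \<bullet> b)) (at 0)"
    using has_real_derivative_along_line[of f x 0 b] assms by simp
  then have "((\<lambda>t. (f (x + t *\<^sub>R b) - f x) / t) \<longlongrightarrow> grad f x \<bullet> b) (at 0)"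
    by (simp add: DERIV_def)
  moreover have "filterlim (\<lambda>n. inverse (real (Suc n))) (at 0) sequentially"
    using LIMSEQ_inverse_real_of_nat by (simp add: filterlim_at)
  ultimately show ?thesis
    by (rule filterlim_compose)
qed

text \<open>Each coordinate is a pointwise limit of difference quotients. These are jointly
  measurable because differentiability gives continuity in the first argument. This is what makes
  the iterates random variables.\<close>

lemma borel_measurable_grad:
  fixes f :: "'v::euclidean_space \<Rightarrow> 's \<Rightarrow> real"
  assumes meas: "\<And>v. f v \<in> borel_measurable S"
    and diff: "\<And>s v. s \<in> space S \<Longrightarrow> (\<lambda>u. f u s) differentiable (at v)"
  shows "(\<lambda>p. grad (\<lambda>u. f u (snd p)) (fst p)) \<in> borel_measurable (borel \<Otimes>\<^sub>M S)"
proof (rule borel_measurable_euclidean_space[THEN iffD2], intro ballI)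
  fix b :: 'v
  have [measurable]: "(\<lambda>p. f (fst p) (snd p)) \<in> borel_measurable (borel \<Otimes>\<^sub>M S)"
    using meas by (rule caratheodory_measurable)
      (use diff in \<open>auto intro: differentiable_imp_continuous_within simp: continuous_on_eq_continuous_at\<close>)
  have shift: "(\<lambda>p. f (fst p + c) (snd p)) \<in> borel_measurable (borel \<Otimes>\<^sub>M S)" for c
    using measurable_compose[of "\<lambda>p. (fst p + c, snd p)" "borel \<Otimes>\<^sub>M S" "borel \<Otimes>\<^sub>M S"
        "\<lambda>p. f (fst p) (snd p)" borel] by simp
  show "(\<lambda>p::'v \<times> 's. grad (\<lambda>u. f u (snd p)) (fst p) \<bullet> b) \<in> borel_measurable (borel \<Otimes>\<^sub>M S)"
  proof (rule borel_measurable_LIMSEQ_metric)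
    show "(\<lambda>p::'v \<times> 's. (f (fst p + inverse (real (Suc n)) *\<^sub>R b) (snd p) - f (fst p) (snd p))
        / inverse (real (Suc n))) \<in> borel_measurable (borel \<Otimes>\<^sub>M S)" for n
      using shift by measurable
  next
    fix p :: "'v \<times> 's" assume "p \<in> space (borel \<Otimes>\<^sub>M S)"
    then show "(\<lambda>n. (f (fst p + inverse (real (Suc n)) *\<^sub>R b) (snd p) - f (fst p) (snd p))
        / inverse (real (Suc n))) \<longlonglongrightarrow> grad (\<lambda>u. f u (snd p)) (fst p) \<bullet> b"
      by (intro grad_inner_LIMSEQ diff) (auto simp: space_pair_measure)
  qed
qed

section \<open>Minimizers and smoothness\<close>

lemma grad_eq_zero_at_minimizer:
  fixes f :: "'v::euclidean_space \<Rightarrow> real"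
  assumes "f differentiable (at x)" and "is_arg_min f (\<lambda>_. True) x"
  shows "grad f x = 0"
proof -
  have "(\<lambda>h. h \<bullet> grad f x) = (\<lambda>h. 0)"
    using GDERIV_grad[OF assms(1)] assms(2)
    by (intro differential_zero_maxmin[of x UNIV f])
      (auto simp: gderiv_def is_arg_min_linorder)
  then show ?thesis
    using inner_eq_zero_iff by metis
qed

text \<open>Along the segment from \<open>x\<close> to \<open>y\<close>, subtract from
  \<open>F\<close> the linear and the quadratic term of the bound. The Lipschitz condition and
  Cauchy-Schwarz make the derivative of the result nonpositive on the unit interval, so its values
  at 0 and 1 compare as claimed.\<close>

lemma lipschitz_grad_quadratic_upper_bound:
  fixes F :: "'v::euclidean_space \<Rightarrow> real"
  assumes diff: "\<And>v. F differentiable (at v)"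
    and lip: "\<And>u v. norm (grad F u - grad F v) \<le> L * norm (u - v)"
  shows "F y \<le> F x + grad F x \<bullet> (y - x) + L / 2 * (norm (y - x))\<^sup>2"
proof -
  define d where "d = y - x"
  define \<phi> where "\<phi> t = F (x + t *\<^sub>R d) - t * (grad F x \<bullet> d) - L / 2 * t\<^sup>2 * (norm d)\<^sup>2" for t
  have "\<exists>D. DERIV \<phi> t :> D \<and> D \<le> 0" if t: "0 \<le> t" "t \<le> 1" for t :: real
  proof (intro exI conjI)
    have "((\<lambda>t. F (x + t *\<^sub>R d)) has_real_derivative (grad F (x + t *\<^sub>R d) \<bullet> d)) (at t)"
      by (intro has_real_derivative_along_line diff)
    then show "DERIV \<phi> t :> grad F (x + t *\<^sub>R d) \<bullet> d - grad F x \<bullet> d - L * t * (norm d)\<^sup>2"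
      unfolding \<phi>_def by (auto intro!: derivative_eq_intros)
    have "(grad F (x + t *\<^sub>R d) - grad F x) \<bullet> d \<le> norm (grad F (x + t *\<^sub>R d) - grad F x) * norm d"
      by (rule norm_cauchy_schwarz)
    also have "\<dots> \<le> (L * norm (t *\<^sub>R d)) * norm d"
      using lip[of "x + t *\<^sub>R d" x] by (intro mult_right_mono) auto
    finally show "grad F (x + t *\<^sub>R d) \<bullet> d - grad F x \<bullet> d - L * t * (norm d)\<^sup>2 \<le> 0"
      using t by (simp add: inner_diff_left power2_eq_square mult_ac)
  qed
  then have "\<phi> 1 \<le> \<phi> 0"
    using DERIV_nonpos_imp_nonincreasing[of 0 1 \<phi>] by force
  then show ?thesis
    by (simp add: \<phi>_def d_def)
qed

section \<open>Freezing the iterate, and descent at a frozen point\<close>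

text \<open>Fubini on the product law plays the part of conditioning on \<open>W\<close>. The bound
  \<open>le\<close> is asked for integrable sections only: Fubini provides integrability for almost
  every \<open>v\<close>, and elsewhere the inner integral is 0 by convention.\<close>

lemma (in prob_space) product_distr_expectation_le:
  fixes \<phi> :: "'v \<times> 's \<Rightarrow> real"
  assumes rv[measurable]: "W \<in> M \<rightarrow>\<^sub>M N" "X \<in> M \<rightarrow>\<^sub>M S"
    and joint: "distr M N W \<Otimes>\<^sub>M distr M S X = distr M (N \<Otimes>\<^sub>M S) (\<lambda>\<omega>. (W \<omega>, X \<omega>))"
    and \<phi>[measurable]: "\<phi> \<in> borel_measurable (N \<Otimes>\<^sub>M S)" and \<phi>_int: "integrable M (\<lambda>\<omega>. \<phi> (W \<omega>, X \<omega>))"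
    and \<psi>[measurable]: "\<psi> \<in> borel_measurable N" and \<psi>_int: "integrable M (\<lambda>\<omega>. \<psi> (W \<omega>))"
    and le: "\<And>v. v \<in> space N \<Longrightarrow> integrable (distr M S X) (\<lambda>s. \<phi> (v, s)) \<Longrightarrow>
      (\<integral>s. \<phi> (v, s) \<partial>distr M S X) \<le> \<psi> v"
  shows "expectation (\<lambda>\<omega>. \<phi> (W \<omega>, X \<omega>)) \<le> expectation (\<lambda>\<omega>. \<psi> (W \<omega>))"
proof -
  interpret W: prob_space "distr M N W" by (rule prob_space_distr) fact
  interpret X: prob_space "distr M S X" by (rule prob_space_distr) fact
  interpret pair_sigma_finite "distr M N W" "distr M S X" ..
  have int: "integrable (distr M N W \<Otimes>\<^sub>M distr M S X) \<phi>"
    unfolding joint using \<phi>_int by (subst integrable_distr_eq) auto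
  have "expectation (\<lambda>\<omega>. \<phi> (W \<omega>, X \<omega>)) = (\<integral>p. \<phi> p \<partial>(distr M N W \<Otimes>\<^sub>M distr M S X))"
    unfolding joint by (subst integral_distr) auto
  also have "\<dots> = (\<integral>v. (\<integral>s. \<phi> (v, s) \<partial>distr M S X) \<partial>distr M N W)"
    using integral_fst'[OF int] by simp
  also have "\<dots> \<le> (\<integral>v. \<psi> v \<partial>distr M N W)"
  proof (rule integral_mono_AE)
    show "integrable (distr M N W) \<psi>"
      using \<psi>_int by (subst integrable_distr_eq) auto
    show "AE v in distr M N W. (\<integral>s. \<phi> (v, s) \<partial>distr M S X) \<le> \<psi> v"
      using AE_integrable_fst'[OF int] AE_space by eventually_elim (simp add: le)
  qed (rule integrable_fst'[OF int])
  also have "\<dots> = expectation (\<lambda>\<omega>. \<psi> (W \<omega>))"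
    by (subst integral_distr) auto
  finally show ?thesis .
qed

text \<open>At a fixed \<open>v\<close> the vector \<open>grad F v\<close> is a constant, so
  unbiasedness evaluates the linear term exactly. The two second-order errors come from the bias
  \<open>H\<close> of the direction, bounded by Cauchy-Schwarz, and from the quadratic term of the
  smoothness bound.\<close>

lemma (in prob_space) expected_descent:
  fixes F :: "'v::euclidean_space \<Rightarrow> real" and G H :: "'v \<Rightarrow> 'v"
  assumes diff: "\<And>v. F differentiable (at v)"
    and lip: "\<And>u v. norm (grad F u - grad F v) \<le> L * norm (u - v)" and L: "L \<ge> 0"
    and G_H: "\<And>x. G x = x - \<alpha> *\<^sub>R H x"
    and G: "\<And>x. norm (G x) \<le> c\<^sub>g * norm x" and H: "\<And>x. norm (H x) \<le> c\<^sub>h * (norm x)\<^sup>2"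
    and g: "integrable M g" "integrable M (\<lambda>\<omega>. (norm (g \<omega>))\<^sup>2)"
    and unbiased: "expectation g = grad F v"
    and int: "integrable M (\<lambda>\<omega>. F (v - \<alpha> *\<^sub>R G (g \<omega>)))"
  shows "expectation (\<lambda>\<omega>. F (v - \<alpha> *\<^sub>R G (g \<omega>))) \<le> F v - \<alpha> * (norm (grad F v))\<^sup>2
    + \<alpha>\<^sup>2 * (c\<^sub>h * norm (grad F v) + L / 2 * c\<^sub>g\<^sup>2) * expectation (\<lambda>\<omega>. (norm (g \<omega>))\<^sup>2)"
proof -
  define D where "D = c\<^sub>h * norm (grad F v) + L / 2 * c\<^sub>g\<^sup>2"
  \<comment> \<open>The right side involves \<open>x\<close> only linearly and through its squared
    norm, so its expectation is determined by the mean and the second moment of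
    \<open>g\<close>.\<close>
  have pointwise: "F (v - \<alpha> *\<^sub>R G x) \<le> F v - \<alpha> * (grad F v \<bullet> x) + \<alpha>\<^sup>2 * D * (norm x)\<^sup>2" for x
  proof -
    have "F (v - \<alpha> *\<^sub>R G x) \<le> F v - \<alpha> * (grad F v \<bullet> G x) + L / 2 * (\<alpha>\<^sup>2 * (norm (G x))\<^sup>2)"
      using lipschitz_grad_quadratic_upper_bound[OF diff lip, of "v - \<alpha> *\<^sub>R G x" v]
      by (simp add: power_mult_distrib)
    moreover have "\<alpha> * (grad F v \<bullet> G x) = \<alpha> * (grad F v \<bullet> x) - \<alpha>\<^sup>2 * (grad F v \<bullet> H x)"
      by (simp add: G_H inner_diff_right algebra_simps power2_eq_square)
    moreover have "\<alpha>\<^sup>2 * (grad F v \<bullet> H x) \<le> \<alpha>\<^sup>2 * (norm (grad F v) * (c\<^sub>h * (norm x)\<^sup>2))"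
      using norm_cauchy_schwarz[of "grad F v" "H x"] mult_left_mono[OF H, of "norm (grad F v)" x]
      by (intro mult_left_mono) auto
    moreover have "L / 2 * (\<alpha>\<^sup>2 * (norm (G x))\<^sup>2) \<le> L / 2 * (\<alpha>\<^sup>2 * (c\<^sub>g * norm x)\<^sup>2)"
      using power_mono[OF G norm_ge_zero, of x 2] L by (intro mult_left_mono) auto
    ultimately show ?thesis
      by (simp add: D_def algebra_simps)
  qed
  have "expectation (\<lambda>\<omega>. F (v - \<alpha> *\<^sub>R G (g \<omega>)))
      \<le> expectation (\<lambda>\<omega>. F v - \<alpha> * (grad F v \<bullet> g \<omega>) + \<alpha>\<^sup>2 * D * (norm (g \<omega>))\<^sup>2)"
    using int g by (intro integral_mono pointwise) auto
  also have "\<dots> = F v - \<alpha> * (grad F v \<bullet> expectation g) + \<alpha>\<^sup>2 * D * expectation (\<lambda>\<omega>. (norm (g \<omega>))\<^sup>2)"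
    using g by (simp add: prob_space)
  finally show ?thesis
    by (simp add: unbiased D_def power2_norm_eq_inner)
qed

section \<open>Moment bounds and joint laws\<close>

text \<open>Lets the third moment of the distance to the minimizer dominate every lower power of
  it.\<close>

lemma power_le_one_plus_power:
  fixes x :: real
  assumes "x \<ge> 0" "m \<le> n"
  shows "x ^ m \<le> 1 + x ^ n"
proof (cases "x \<le> 1")
  case True
  then show ?thesis
    using assms power_le_one[of x m] zero_le_power[of x n] by linarith
next
  case False
  then show ?thesis
    using power_increasing[of m n x] assms by linarith
qed

lemma (in prob_space) integrable_polynomial_growth:
  fixes W :: "'a \<Rightarrow> 'v::{real_normed_vector, second_countable_topology}" and h :: "'v \<Rightarrow> real"
  assumes [measurable]: "W \<in> borel_measurable M" "h \<in> borel_measurable borel"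
    and moment: "integrable M (\<lambda>\<omega>. norm (W \<omega> - c) ^ n)"
    and growth: "\<And>v. \<bar>h v\<bar> \<le> C * (1 + norm (v - c) ^ n)"
  shows "integrable M (\<lambda>\<omega>. h (W \<omega>))"
proof (rule Bochner_Integration.integrable_bound)
  show "integrable M (\<lambda>\<omega>. C * (1 + norm (W \<omega> - c) ^ n))"
    using moment by simp
  show "AE \<omega> in M. norm (h (W \<omega>)) \<le> norm (C * (1 + norm (W \<omega> - c) ^ n))"
    using growth by (auto intro: order_trans[OF _ abs_ge_self])
qed measurable

text \<open>In the application \<open>g\<close> and \<open>h\<close> are the stochastic gradients at
  a point and at the minimizer, and \<open>r\<close> is the distance between the two points. The
  estimate is the triangle inequality followed by
  \<open>(a + b)\<^sup>2 \<le> 2 * a\<^sup>2 + 2 * b\<^sup>2\<close>.\<close>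

lemma second_moment_lipschitz:
  fixes g h :: "'a \<Rightarrow> 'v::euclidean_space"
  assumes [measurable]: "g \<in> borel_measurable M"
    and \<Lambda>: "integrable M (\<lambda>\<omega>. (\<Lambda> \<omega>)\<^sup>2)" "(\<integral>\<omega>. (\<Lambda> \<omega>)\<^sup>2 \<partial>M) \<le> L\<^sup>2"
    and h: "integrable M (\<lambda>\<omega>. (norm (h \<omega>))\<^sup>2)" "(\<integral>\<omega>. (norm (h \<omega>))\<^sup>2 \<partial>M) \<le> \<sigma>\<^sup>2"
    and lip: "AE \<omega> in M. norm (g \<omega> - h \<omega>) \<le> \<Lambda> \<omega> * r"
  shows "integrable M (\<lambda>\<omega>. (norm (g \<omega>))\<^sup>2)"
    and "(\<integral>\<omega>. (norm (g \<omega>))\<^sup>2 \<partial>M) \<le> 2 * L\<^sup>2 * r\<^sup>2 + 2 * \<sigma>\<^sup>2"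
proof -
  let ?b = "\<lambda>\<omega>. 2 * r\<^sup>2 * (\<Lambda> \<omega>)\<^sup>2 + 2 * (norm (h \<omega>))\<^sup>2"
  have int: "integrable M ?b"
    using \<Lambda> h by simp
  have le: "AE \<omega> in M. (norm (g \<omega>))\<^sup>2 \<le> ?b \<omega>"
    using lip
  proof eventually_elim
    case (elim \<omega>)
    have "norm (g \<omega>) \<le> \<Lambda> \<omega> * r + norm (h \<omega>)"
      using norm_triangle_sub[of "g \<omega>" "h \<omega>"] elim by simp
    then have "(norm (g \<omega>))\<^sup>2 \<le> (\<Lambda> \<omega> * r + norm (h \<omega>))\<^sup>2"
      by (intro power_mono) auto
    also have "\<dots> \<le> ?b \<omega>"
      \<comment> \<open>The gap between the two sides is exactly this square.\<close>
      using zero_le_power2[of "\<Lambda> \<omega> * r - norm (h \<omega>)"]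
      by (simp add: power2_sum power2_diff power_mult_distrib mult.commute)
    finally show ?case .
  qed
  show *: "integrable M (\<lambda>\<omega>. (norm (g \<omega>))\<^sup>2)"
    using int by (rule Bochner_Integration.integrable_bound) (use le in \<open>auto simp: abs_of_nonneg\<close>)
  have "(\<integral>\<omega>. (norm (g \<omega>))\<^sup>2 \<partial>M) \<le> (\<integral>\<omega>. ?b \<omega> \<partial>M)"
    using * int le by (rule integral_mono_AE)
  also have "\<dots> = 2 * r\<^sup>2 * (\<integral>\<omega>. (\<Lambda> \<omega>)\<^sup>2 \<partial>M) + 2 * (\<integral>\<omega>. (norm (h \<omega>))\<^sup>2 \<partial>M)"
    using \<Lambda> h by simp
  also have "\<dots> \<le> 2 * r\<^sup>2 * L\<^sup>2 + 2 * \<sigma>\<^sup>2"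
    using \<Lambda> h by (intro add_mono mult_left_mono) auto
  finally show "(\<integral>\<omega>. (norm (g \<omega>))\<^sup>2 \<partial>M) \<le> 2 * L\<^sup>2 * r\<^sup>2 + 2 * \<sigma>\<^sup>2"
    by (simp add: mult_ac)
qed

text \<open>\<open>indep_var\<close> only relates variables of one type, so independence of an iterate and a data
  point is expressed through their joint distribution.\<close>

lemma (in prob_space) indep_var_compose_joint_distr:
  assumes indep: "indep_var A U B V"
    and [measurable]: "Y \<in> A \<rightarrow>\<^sub>M N" "Z \<in> B \<rightarrow>\<^sub>M S"
  shows "distr M N (\<lambda>\<omega>. Y (U \<omega>)) \<Otimes>\<^sub>M distr M S (\<lambda>\<omega>. Z (V \<omega>))
    = distr M (N \<Otimes>\<^sub>M S) (\<lambda>\<omega>. (Y (U \<omega>), Z (V \<omega>)))"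
proof -
  have [measurable]: "U \<in> M \<rightarrow>\<^sub>M A" "V \<in> M \<rightarrow>\<^sub>M B"
    and joint: "distr M A U \<Otimes>\<^sub>M distr M B V = distr M (A \<Otimes>\<^sub>M B) (\<lambda>\<omega>. (U \<omega>, V \<omega>))"
    using indep by (auto simp: indep_var_distribution_eq)
  interpret V: prob_space "distr M B V" by (rule prob_space_distr) measurable
  interpret Z: prob_space "distr (distr M B V) S Z" by (rule V.prob_space_distr) simp
  have "distr M N (\<lambda>\<omega>. Y (U \<omega>)) \<Otimes>\<^sub>M distr M S (\<lambda>\<omega>. Z (V \<omega>))
      = distr (distr M A U) N Y \<Otimes>\<^sub>M distr (distr M B V) S Z"
    by (simp add: distr_distr o_def)
  also have "\<dots> = distr (distr M A U \<Otimes>\<^sub>M distr M B V) (N \<Otimes>\<^sub>M S) (\<lambda>(x, y). (Y x, Z y))"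
    by (rule pair_measure_distr) (simp_all add: Z.sigma_finite_measure_axioms)
  also have "\<dots> = distr M (N \<Otimes>\<^sub>M S) (\<lambda>\<omega>. (Y (U \<omega>), Z (V \<omega>)))"
    unfolding joint by (subst distr_distr) (auto simp: o_def)
  finally show ?thesis .
qed

section \<open>Independence of each iterate from the next data point\<close>

text \<open>Unrolling the recursion: the first iterate is constant and each step brings in one new
  data point. The index set stops before \<open>k\<close> because \<open>X k\<close> first enters
  the iterate \<open>k + 1\<close>.\<close>

lemma sgd_iterate_factors_through_past:
  fixes f :: "'v::euclidean_space \<Rightarrow> 's \<Rightarrow> real"
  assumes iter: "sgd_iterates M f G X \<alpha> K w\<^sub>1 w"
    and f_meas: "\<And>v. f v \<in> borel_measurable S"
    and f_diff: "\<And>s v. s \<in> space S \<Longrightarrow> (\<lambda>u. f u s) differentiable (at v)"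
    and G_meas: "\<And>k. k \<in> {1..K} \<Longrightarrow> (\<lambda>x. G x (\<alpha> k)) \<in> borel_measurable borel"
    and k: "1 \<le> k" "k \<le> K + 1"
  shows "\<exists>W \<in> borel_measurable (Pi\<^sub>M {1..<k} (\<lambda>_. S)). \<forall>\<omega>\<in>space M. w k \<omega> = W (\<lambda>i\<in>{1..<k}. X i \<omega>)"
  using k
proof (induction k rule: nat_induct_at_least)
  case base
  show ?case
    using iter by (intro bexI[of _ "\<lambda>_. w\<^sub>1"]) (auto simp: sgd_iterates_def)
next
  case (Suc k)
  then obtain W where W_meas: "W \<in> borel_measurable (Pi\<^sub>M {1..<k} (\<lambda>_. S))"
    and W: "\<And>\<omega>. \<omega> \<in> space M \<Longrightarrow> w k \<omega> = W (\<lambda>i\<in>{1..<k}. X i \<omega>)"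
    by (metis Suc_leD)
  let ?P = "Pi\<^sub>M {1..<Suc k} (\<lambda>_. S)"
  \<comment> \<open>The previous iterate, read as a function of the longer data vector whose extra
    coordinate \<open>x k\<close> is the fresh data point.\<close>
  define V where "V x = W (restrict x {1..<k})" for x
  have V: "V \<in> borel_measurable ?P"
    unfolding V_def
    by (rule measurable_compose[OF measurable_restrict_subset W_meas]) auto
  have "(\<lambda>x. (V x, x k)) \<in> ?P \<rightarrow>\<^sub>M borel \<Otimes>\<^sub>M S"
    using V Suc by (intro measurable_Pair measurable_component_singleton) auto
  from measurable_compose[OF this borel_measurable_grad[OF f_meas f_diff]]
  have "(\<lambda>x. grad (\<lambda>u. f u (x k)) (V x)) \<in> borel_measurable ?P"
    by simp
  from measurable_compose[OF this G_meas[of k]] Suc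
  have [measurable]: "(\<lambda>x. G (grad (\<lambda>u. f u (x k)) (V x)) (\<alpha> k)) \<in> borel_measurable ?P"
    by simp
  note [measurable] = V
  show ?case
  proof (intro bexI ballI)
    fix \<omega> assume \<omega>: "\<omega> \<in> space M"
    have "restrict (\<lambda>i\<in>{1..<Suc k}. X i \<omega>) {1..<k} = (\<lambda>i\<in>{1..<k}. X i \<omega>)"
      by auto
    then show "w (Suc k) \<omega> = (\<lambda>x. V x - \<alpha> k *\<^sub>R G (grad (\<lambda>u. f u (x k)) (V x)) (\<alpha> k))
        (\<lambda>i\<in>{1..<Suc k}. X i \<omega>)"
      using iter Suc \<omega> by (auto simp: sgd_iterates_def V_def W)
  qed measurable
qed

text \<open>The index blocks \<open>{1..<k}\<close> and \<open>{k}\<close> are disjoint, so the two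
  data vectors are independent. The iterate is a measurable function of the first vector, and
  \<open>X k\<close> is the only coordinate of the second.\<close>

lemma (in prob_space) sgd_iterate_independent_of_data:
  fixes f :: "'v::euclidean_space \<Rightarrow> 's \<Rightarrow> real"
  assumes indep: "indep_vars (\<lambda>_. S) X {1..}"
    and iter: "sgd_iterates M f G X \<alpha> K w\<^sub>1 w"
    and f_meas: "\<And>v. f v \<in> borel_measurable S"
    and f_diff: "\<And>s v. s \<in> space S \<Longrightarrow> (\<lambda>u. f u s) differentiable (at v)"
    and G_meas: "\<And>k. k \<in> {1..K} \<Longrightarrow> (\<lambda>x. G x (\<alpha> k)) \<in> borel_measurable borel"
    and k: "1 \<le> k" "k \<le> K + 1"
  shows "w k \<in> borel_measurable M"
    and "distr M borel (w k) \<Otimes>\<^sub>M distr M S (X k) = distr M (borel \<Otimes>\<^sub>M S) (\<lambda>\<omega>. (w k \<omega>, X k \<omega>))"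
proof -
  let ?U = "\<lambda>\<omega>. \<lambda>i\<in>{1..<k}. X i \<omega>" and ?V = "\<lambda>\<omega>. \<lambda>i\<in>{k}. X i \<omega>"
  obtain W where W[measurable]: "W \<in> borel_measurable (Pi\<^sub>M {1..<k} (\<lambda>_. S))"
    and w: "\<And>\<omega>. \<omega> \<in> space M \<Longrightarrow> w k \<omega> = W (?U \<omega>)"
    using sgd_iterate_factors_through_past[OF iter f_meas f_diff G_meas k] by blast
  have UV: "indep_var (Pi\<^sub>M {1..<k} (\<lambda>_. S)) ?U (Pi\<^sub>M {k} (\<lambda>_. S)) ?V"
    using k by (intro indep_var_restrict[OF indep]) auto
  then have "?U \<in> M \<rightarrow>\<^sub>M Pi\<^sub>M {1..<k} (\<lambda>_. S)"
    by (rule indep_var_rv1)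
  from measurable_compose[OF this W] show "w k \<in> borel_measurable M"
    by (subst measurable_cong[OF w])
  have "(\<lambda>x. x k) \<in> Pi\<^sub>M {k} (\<lambda>_. S) \<rightarrow>\<^sub>M S"
    by measurable
  from indep_var_compose_joint_distr[OF UV W this]
  show "distr M borel (w k) \<Otimes>\<^sub>M distr M S (X k) = distr M (borel \<Otimes>\<^sub>M S) (\<lambda>\<omega>. (w k \<omega>, X k \<omega>))"
    by (simp add: w cong: distr_cong)
qed

section \<open>Telescoping and the descent of one random step\<close>

text \<open>The minimum is at most the average, and the step inequality bounds each
  \<open>\<alpha> * b k\<close> by a telescoping difference plus \<open>e\<close>.\<close>

lemma Min_le_telescope:
  fixes a b :: "nat \<Rightarrow> real"
  assumes "K \<ge> 1" and "\<alpha> \<ge> 0"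
    and step: "\<And>k. k \<in> {1..K} \<Longrightarrow> a (k + 1) \<le> a k - \<alpha> * b k + e"
    and "m \<le> a (K + 1)"
  shows "\<alpha> * real K * Min (b ` {1..K}) \<le> a 1 - m + real K * e"
proof -
  have "real K * Min (b ` {1..K}) \<le> (\<Sum>k=1..K. b k)"
    using sum_bounded_below[of "{1..K}" "Min (b ` {1..K})" b] by simp
  then have "\<alpha> * real K * Min (b ` {1..K}) \<le> (\<Sum>k=1..K. \<alpha> * b k)"
    using assms(2) by (simp add: mult.assoc mult_left_mono flip: sum_distrib_left)
  also have "\<dots> \<le> (\<Sum>k=1..K. (a k - a (Suc k)) + e)"
    using step by (intro sum_mono) (simp add: algebra_simps)
  also have "\<dots> = a 1 - a (K + 1) + real K * e"
    using sum_Suc_diff[of 1 "K" "\<lambda>k. - a k"] assms(1) by (simp add: sum.distrib)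
  finally show ?thesis
    using assms(4) by simp
qed

text \<open>The descent at a frozen point, integrated over the law of the iterate \<open>W\<close>;
  \<open>c\<close> is the minimizer. Third moments of the current and of the next iterate make
  \<open>F\<close> integrable at both, since \<open>F\<close> grows at most quadratically around
  \<open>c\<close>.\<close>

lemma (in prob_space) sgd_step_expected_descent:
  fixes F :: "'v::euclidean_space \<Rightarrow> real" and G H :: "'v \<Rightarrow> 'v" and g :: "'v \<Rightarrow> 's \<Rightarrow> 'v"
  assumes rv[measurable]: "W \<in> borel_measurable M" "X \<in> M \<rightarrow>\<^sub>M S"
    and joint: "distr M borel W \<Otimes>\<^sub>M distr M S X = distr M (borel \<Otimes>\<^sub>M S) (\<lambda>\<omega>. (W \<omega>, X \<omega>))"
    and diff: "\<And>v. F differentiable (at v)"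
    and lip: "\<And>u v. norm (grad F u - grad F v) \<le> L * norm (u - v)" and L: "L \<ge> 0"
    and minimizer: "is_arg_min F (\<lambda>_. True) c"
    and G_H: "\<And>x. G x = x - \<alpha> *\<^sub>R H x"
    and G: "\<And>x. norm (G x) \<le> c\<^sub>g * norm x" and H: "\<And>x. norm (H x) \<le> c\<^sub>h * (norm x)\<^sup>2" "c\<^sub>h \<ge> 0"
    and G_meas[measurable]: "G \<in> borel_measurable borel"
    and g_meas[measurable]: "(\<lambda>p. g (fst p) (snd p)) \<in> borel_measurable (borel \<Otimes>\<^sub>M S)"
    and g_int: "\<And>v. integrable (distr M S X) (g v)"
    and unbiased: "\<And>v. (\<integral>s. g v s \<partial>distr M S X) = grad F v"
    and g_int2: "\<And>v. integrable (distr M S X) (\<lambda>s. (norm (g v s))\<^sup>2)"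
    and second: "\<And>v. (\<integral>s. (norm (g v s))\<^sup>2 \<partial>distr M S X) \<le> 2 * L\<^sup>2 * (norm (v - c))\<^sup>2 + 2 * \<sigma>\<^sup>2"
    and moment: "integrable M (\<lambda>\<omega>. norm (W \<omega> - c) ^ 3)"
    and moment': "integrable M (\<lambda>\<omega>. norm (W \<omega> - \<alpha> *\<^sub>R G (g (W \<omega>) (X \<omega>)) - c) ^ 3)"
  shows "integrable M (\<lambda>\<omega>. (norm (grad F (W \<omega>)))\<^sup>2)"
    and "integrable M (\<lambda>\<omega>. F (W \<omega> - \<alpha> *\<^sub>R G (g (W \<omega>) (X \<omega>))))"
    and "expectation (\<lambda>\<omega>. F (W \<omega> - \<alpha> *\<^sub>R G (g (W \<omega>) (X \<omega>)))) \<le> expectation (\<lambda>\<omega>. F (W \<omega>))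
      - \<alpha> * expectation (\<lambda>\<omega>. (norm (grad F (W \<omega>)))\<^sup>2)
      + \<alpha>\<^sup>2 * ((c\<^sub>h * L + L / 2 * c\<^sub>g\<^sup>2) * (2 * L\<^sup>2 + 2 * \<sigma>\<^sup>2) * (1 + expectation (\<lambda>\<omega>. norm (W \<omega> - c) ^ 3)))"
proof -
  \<comment> \<open>This is the value at \<open>r = 1\<close> of the error factor \<open>(c\<^sub>h
    * L * r + L / 2 * c\<^sub>g\<^sup>2) * (2 * L\<^sup>2 * r\<^sup>2 + 2 *
    \<sigma>\<^sup>2)\<close>, a cubic in \<open>r = norm (v - c)\<close> with nonnegative
    coefficients, which is therefore at most \<open>D * (1 + r ^ 3)\<close>.\<close>
  define D where "D = (c\<^sub>h * L + L / 2 * c\<^sub>g\<^sup>2) * (2 * L\<^sup>2 + 2 * \<sigma>\<^sup>2)"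
  have grad_le: "norm (grad F v) \<le> L * norm (v - c)" for v
    using lip[of v c] grad_eq_zero_at_minimizer[OF diff minimizer] by simp
  have "continuous_on UNIV F"
    using diff by (auto intro: differentiable_imp_continuous_within simp: continuous_on_eq_continuous_at)
  then have [measurable]: "F \<in> borel_measurable borel"
    by (rule borel_measurable_continuous_onI)
  have "L-lipschitz_on UNIV (grad F)"
    using lip L by (auto simp: lipschitz_on_def dist_norm)
  then have [measurable]: "grad F \<in> borel_measurable borel"
    by (intro borel_measurable_continuous_onI lipschitz_on_continuous_on)
  \<comment> \<open>Minimality bounds \<open>F v\<close> from below by \<open>F c\<close>;
    smoothness at \<open>c\<close>, where the gradient vanishes, bounds it from above by a
    quadratic.\<close>
  have F_growth: "\<bar>F v\<bar> \<le> (\<bar>F c\<bar> + L / 2) * (1 + norm (v - c) ^ 3)" for v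
  proof -
    have "F c \<le> F v"
      using minimizer by (simp add: is_arg_min_linorder)
    moreover have "F v \<le> F c + L / 2 * (norm (v - c))\<^sup>2"
      using lipschitz_grad_quadratic_upper_bound[OF diff lip, of v c]
        grad_eq_zero_at_minimizer[OF diff minimizer] by simp
    moreover have "L / 2 * (norm (v - c))\<^sup>2 \<le> L / 2 * (1 + norm (v - c) ^ 3)"
      using L by (intro mult_left_mono power_le_one_plus_power) auto
    moreover have "\<bar>F c\<bar> \<le> \<bar>F c\<bar> * (1 + norm (v - c) ^ 3)"
      by (simp add: algebra_simps)
    ultimately show ?thesis
      using L zero_le_power2[of "norm (v - c)"] by (simp add: distrib_right)
  qed
  have gradsq_growth: "\<bar>(norm (grad F v))\<^sup>2\<bar> \<le> L\<^sup>2 * (1 + norm (v - c) ^ 3)" for v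
  proof -
    have "(norm (grad F v))\<^sup>2 \<le> L\<^sup>2 * (norm (v - c))\<^sup>2"
      using power_mono[OF grad_le, of v 2] by (simp add: power_mult_distrib)
    also have "\<dots> \<le> L\<^sup>2 * (1 + norm (v - c) ^ 3)"
      by (intro mult_left_mono power_le_one_plus_power) auto
    finally show ?thesis
      by simp
  qed
  show gradsq_int: "integrable M (\<lambda>\<omega>. (norm (grad F (W \<omega>)))\<^sup>2)"
    by (rule integrable_polynomial_growth[OF _ _ moment gradsq_growth]) measurable
  have F_int: "integrable M (\<lambda>\<omega>. F (W \<omega>))"
    by (rule integrable_polynomial_growth[OF _ _ moment F_growth]) measurable
  have [measurable]: "(\<lambda>\<omega>. g (W \<omega>) (X \<omega>)) \<in> borel_measurable M"
    using measurable_compose[of "\<lambda>\<omega>. (W \<omega>, X \<omega>)" M _ _ borel, OF _ g_meas] by simp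
  show F_int': "integrable M (\<lambda>\<omega>. F (W \<omega> - \<alpha> *\<^sub>R G (g (W \<omega>) (X \<omega>))))"
    by (rule integrable_polynomial_growth[OF _ _ moment' F_growth]) measurable
  interpret X: prob_space "distr M S X"
    by (rule prob_space_distr) measurable
  define \<phi> where "\<phi> = (\<lambda>p. F (fst p - \<alpha> *\<^sub>R G (g (fst p) (snd p))))"
  define \<psi> where "\<psi> v = F v - \<alpha> * (norm (grad F v))\<^sup>2 + \<alpha>\<^sup>2 * (D * (1 + norm (v - c) ^ 3))" for v
  have "expectation (\<lambda>\<omega>. \<phi> (W \<omega>, X \<omega>)) \<le> expectation (\<lambda>\<omega>. \<psi> (W \<omega>))"
  proof (rule product_distr_expectation_le[OF rv joint])
    show "\<phi> \<in> borel_measurable (borel \<Otimes>\<^sub>M S)"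
      unfolding \<phi>_def by measurable
    show "integrable M (\<lambda>\<omega>. \<phi> (W \<omega>, X \<omega>))"
      unfolding \<phi>_def using F_int' by simp
    show "\<psi> \<in> borel_measurable borel"
      unfolding \<psi>_def by measurable
    show "integrable M (\<lambda>\<omega>. \<psi> (W \<omega>))"
      unfolding \<psi>_def using F_int gradsq_int moment by simp
    fix v assume "integrable (distr M S X) (\<lambda>s. \<phi> (v, s))"
    then have "(\<integral>s. \<phi> (v, s) \<partial>distr M S X) \<le> F v - \<alpha> * (norm (grad F v))\<^sup>2
      + \<alpha>\<^sup>2 * (c\<^sub>h * norm (grad F v) + L / 2 * c\<^sub>g\<^sup>2) * (\<integral>s. (norm (g v s))\<^sup>2 \<partial>distr M S X)"
      using X.expected_descent[OF diff lip L G_H G H(1) g_int g_int2 unbiased]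
      by (simp add: \<phi>_def)
    also have "\<alpha>\<^sup>2 * (c\<^sub>h * norm (grad F v) + L / 2 * c\<^sub>g\<^sup>2) * (\<integral>s. (norm (g v s))\<^sup>2 \<partial>distr M S X)
        = \<alpha>\<^sup>2 * ((c\<^sub>h * norm (grad F v) + L / 2 * c\<^sub>g\<^sup>2) * (\<integral>s. (norm (g v s))\<^sup>2 \<partial>distr M S X))"
      by (rule mult.assoc)
    also have "(c\<^sub>h * norm (grad F v) + L / 2 * c\<^sub>g\<^sup>2) * (\<integral>s. (norm (g v s))\<^sup>2 \<partial>distr M S X)
        \<le> (c\<^sub>h * (L * norm (v - c)) + L / 2 * c\<^sub>g\<^sup>2) * (2 * L\<^sup>2 * (norm (v - c))\<^sup>2 + 2 * \<sigma>\<^sup>2)"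
      using grad_le second L H(2) by (intro mult_mono add_right_mono mult_left_mono) auto
    also have "\<dots> \<le> D * (1 + norm (v - c) ^ 3)"
    proof -
      let ?r = "norm (v - c)"
      \<comment> \<open>The four terms of the expanded product, with exponents 3, 1, 2 and 0 written
        out so that one power inequality covers all of them.\<close>
      have "c\<^sub>h * L * 2 * L\<^sup>2 * ?r ^ 3 \<le> c\<^sub>h * L * 2 * L\<^sup>2 * (1 + ?r ^ 3)"
        "c\<^sub>h * L * 2 * \<sigma>\<^sup>2 * ?r ^ 1 \<le> c\<^sub>h * L * 2 * \<sigma>\<^sup>2 * (1 + ?r ^ 3)"
        "L / 2 * c\<^sub>g\<^sup>2 * 2 * L\<^sup>2 * ?r ^ 2 \<le> L / 2 * c\<^sub>g\<^sup>2 * 2 * L\<^sup>2 * (1 + ?r ^ 3)"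
        "L / 2 * c\<^sub>g\<^sup>2 * 2 * \<sigma>\<^sup>2 * ?r ^ 0 \<le> L / 2 * c\<^sub>g\<^sup>2 * 2 * \<sigma>\<^sup>2 * (1 + ?r ^ 3)"
        using L H(2) by (intro mult_left_mono power_le_one_plus_power; simp)+
      then show ?thesis
        by (simp add: D_def algebra_simps power2_eq_square power3_eq_cube)
    qed
    finally show "(\<integral>s. \<phi> (v, s) \<partial>distr M S X) \<le> \<psi> v"
      by (simp add: \<psi>_def mult_left_mono)
  qed
  also have "expectation (\<lambda>\<omega>. \<psi> (W \<omega>)) = expectation (\<lambda>\<omega>. F (W \<omega>))
      - \<alpha> * expectation (\<lambda>\<omega>. (norm (grad F (W \<omega>)))\<^sup>2)
      + \<alpha>\<^sup>2 * (D * (1 + expectation (\<lambda>\<omega>. norm (W \<omega> - c) ^ 3)))"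
    unfolding \<psi>_def using F_int gradsq_int moment by (simp add: prob_space)
  finally show "expectation (\<lambda>\<omega>. F (W \<omega> - \<alpha> *\<^sub>R G (g (W \<omega>) (X \<omega>)))) \<le> expectation (\<lambda>\<omega>. F (W \<omega>))
      - \<alpha> * expectation (\<lambda>\<omega>. (norm (grad F (W \<omega>)))\<^sup>2)
      + \<alpha>\<^sup>2 * ((c\<^sub>h * L + L / 2 * c\<^sub>g\<^sup>2) * (2 * L\<^sup>2 + 2 * \<sigma>\<^sup>2) * (1 + expectation (\<lambda>\<omega>. norm (W \<omega> - c) ^ 3)))"
    by (simp add: \<phi>_def D_def)
qed

section \<open>The convergence rate for step size \<open>1 / sqrt K\<close>\<close>

theorem corollary6:
  fixes M :: "'a measure" and S :: "'s measure"
    and X :: "nat \<Rightarrow> 'a \<Rightarrow> 's" and \<xi> :: "'a \<Rightarrow> 's"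
    and f :: "real ^ 'n \<Rightarrow> 's \<Rightarrow> real" and F :: "real ^ 'n \<Rightarrow> real"
    and G H :: "real ^ 'n \<Rightarrow> real \<Rightarrow> real ^ 'n"
    and c\<^sub>g c\<^sub>h L B :: real and L\<xi> :: "'a \<Rightarrow> real"
    and w\<^sub>1 w_star :: "real ^ 'n"
    and w :: "nat \<Rightarrow> nat \<Rightarrow> 'a \<Rightarrow> real ^ 'n"
  assumes prob: "prob_space M" and complete: "complete_measure M"
    and iid_indep: "prob_space.indep_vars M (\<lambda>_. S) X {1..}"
    and xi_rv: "\<xi> \<in> measurable M S"
    and iid_distr: "\<And>k. k \<ge> 1 \<Longrightarrow> distr M S (X k) = distr M S \<xi>"
    and f_meas: "\<And>v. f v \<in> borel_measurable S"
    and f_diff: "\<And>s v. s \<in> space S \<Longrightarrow> (\<lambda>u. f u s) differentiable (at v)"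
    and f_int: "\<And>v. integrable M (\<lambda>\<omega>. f v (\<xi> \<omega>))"
    and F_eq: "\<And>v. F v = (\<integral>\<omega>. f v (\<xi> \<omega>) \<partial>M)"
    and G_meas: "\<And>\<alpha>. \<alpha> > 0 \<Longrightarrow> (\<lambda>x. G x \<alpha>) \<in> borel_measurable borel"
    and G_H: "\<And>x \<alpha>. \<alpha> > 0 \<Longrightarrow> G x \<alpha> = x - \<alpha> *\<^sub>R H x \<alpha>"
    and A1: "c\<^sub>g > 0" "c\<^sub>h \<ge> 0"
      "\<And>x \<alpha>. \<alpha> > 0 \<Longrightarrow> norm (G x \<alpha>) \<le> c\<^sub>g * norm x"
      "\<And>x \<alpha>. \<alpha> > 0 \<Longrightarrow> norm (H x \<alpha>) \<le> c\<^sub>h * (norm x)\<^sup>2"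
    and A2: "\<And>v. integrable M (\<lambda>\<omega>. grad (\<lambda>u. f u (\<xi> \<omega>)) v)"
      "\<And>v. (\<integral>\<omega>. grad (\<lambda>u. f u (\<xi> \<omega>)) v \<partial>M) = grad F v"
    and A3_F: "\<And>v. F differentiable (at v)" "continuous_on UNIV (grad F)" "L > 0"
      "\<And>u v. norm (grad F u - grad F v) \<le> L * norm (u - v)"
    and A3_f: "L\<xi> \<in> borel_measurable (vimage_algebra (space M) \<xi> S)"
      "\<And>\<omega>. \<omega> \<in> space M \<Longrightarrow> L\<xi> \<omega> > 0"
      "integrable M (\<lambda>\<omega>. (L\<xi> \<omega>)\<^sup>2)"
      "AE \<omega> in M. \<forall>u v. norm (grad (\<lambda>x. f x (\<xi> \<omega>)) u - grad (\<lambda>x. f x (\<xi> \<omega>)) v)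
                          \<le> L\<xi> \<omega> * norm (u - v)"
      "(\<integral>\<omega>. (L\<xi> \<omega>)\<^sup>2 \<partial>M) \<le> L\<^sup>2"
    and iterates: "\<And>K. K \<ge> 1 \<Longrightarrow> sgd_iterates M f G X (\<lambda>_. 1 / sqrt (real K)) K w\<^sub>1 (w K)"
    and minimizer: "is_arg_min F (\<lambda>_. True) w_star"
    and A4_or_A5:
      "(\<exists>\<sigma>::real. integrable M (\<lambda>\<omega>. (norm (grad (\<lambda>u. f u (\<xi> \<omega>)) w_star))\<^sup>2) \<and>
          (\<integral>\<omega>. (norm (grad (\<lambda>u. f u (\<xi> \<omega>)) w_star))\<^sup>2 \<partial>M) \<le> \<sigma>\<^sup>2)
       \<or> (AE \<omega> in M. is_arg_min (\<lambda>u. f u (\<xi> \<omega>)) (\<lambda>_. True) w_star)"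
    and A6: "B > 0"
      "\<And>K k. K \<ge> 1 \<Longrightarrow> k \<in> {1..K + 1} \<Longrightarrow>
         integrable M (\<lambda>\<omega>. norm (w K k \<omega> - w_star) ^ 3) \<and>
         (\<integral>\<omega>. norm (w K k \<omega> - w_star) ^ 3 \<partial>M) \<le> B"
  shows "\<exists>C::real. \<forall>K\<ge>1.
      (\<forall>k\<in>{1..K}. integrable M (\<lambda>\<omega>. (norm (grad F (w K k \<omega>)))\<^sup>2)) \<and>
      Min ((\<lambda>k. \<integral>\<omega>. (norm (grad F (w K k \<omega>)))\<^sup>2 \<partial>M) ` {1..K}) \<le> C / sqrt (real K)"
proof -
  interpret prob_space M by (rule prob)
  let ?g = "\<lambda>v s. grad (\<lambda>u. f u s) v"
  let ?\<mu> = "distr M S \<xi>"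
  have g_meas: "(\<lambda>p. ?g (fst p) (snd p)) \<in> borel_measurable (borel \<Otimes>\<^sub>M S)"
    by (rule borel_measurable_grad[OF f_meas f_diff])
  have g_meas_S[measurable]: "?g v \<in> borel_measurable S" for v
    using measurable_compose[of "\<lambda>s. (v, s)" S _ _ borel, OF _ g_meas] by simp
  note [measurable] = xi_rv
  \<comment> \<open>Merges the two alternatives: under interpolation the stochastic gradient at
    \<open>w_star\<close> vanishes almost surely, so the variance bound holds with 0.\<close>
  obtain \<sigma> where \<sigma>: "integrable M (\<lambda>\<omega>. (norm (?g w_star (\<xi> \<omega>)))\<^sup>2)"
    "(\<integral>\<omega>. (norm (?g w_star (\<xi> \<omega>)))\<^sup>2 \<partial>M) \<le> \<sigma>\<^sup>2"
    using A4_or_A5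
  proof (elim disjE exE conjE)
    assume "AE \<omega> in M. is_arg_min (\<lambda>u. f u (\<xi> \<omega>)) (\<lambda>_. True) w_star"
    with AE_space have ae: "AE \<omega> in M. (norm (?g w_star (\<xi> \<omega>)))\<^sup>2 = 0"
    proof eventually_elim
      case (elim \<omega>)
      then show ?case
        using grad_eq_zero_at_minimizer[OF f_diff] measurable_space[OF xi_rv] by simp
    qed
    have "integrable M (\<lambda>\<omega>. (norm (?g w_star (\<xi> \<omega>)))\<^sup>2)"
      by (rule integrable_cong_AE_imp[where g = "\<lambda>_. 0"]) (use ae in \<open>auto\<close>)
    moreover have "(\<integral>\<omega>. (norm (?g w_star (\<xi> \<omega>)))\<^sup>2 \<partial>M) = 0"
      using ae by (rule integral_eq_zero_AE)
    ultimately show thesis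
      using that[of 0] by simp
  qed (rule that)
  define D where "D = (c\<^sub>h * L + L / 2 * c\<^sub>g\<^sup>2) * (2 * L\<^sup>2 + 2 * \<sigma>\<^sup>2)"
  have "D \<ge> 0"
    using A1 A3_F(3) by (simp add: D_def)
  have g_second: "integrable ?\<mu> (\<lambda>s. (norm (?g v s))\<^sup>2)"
    "(\<integral>s. (norm (?g v s))\<^sup>2 \<partial>?\<mu>) \<le> 2 * L\<^sup>2 * (norm (v - w_star))\<^sup>2 + 2 * \<sigma>\<^sup>2" for v
  proof -
    \<comment> \<open>The factor \<open>L\<xi>\<close> is a function on the probability space, so
      the moment bound is proved over \<open>M\<close> and then transported to the law of
      \<open>\<xi>\<close>.\<close>
    have "AE \<omega> in M. norm (?g v (\<xi> \<omega>) - ?g w_star (\<xi> \<omega>)) \<le> L\<xi> \<omega> * norm (v - w_star)"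
      using A3_f(4) by eventually_elim blast
    from second_moment_lipschitz[OF _ A3_f(3,5) \<sigma> this]
    show "integrable ?\<mu> (\<lambda>s. (norm (?g v s))\<^sup>2)"
      "(\<integral>s. (norm (?g v s))\<^sup>2 \<partial>?\<mu>) \<le> 2 * L\<^sup>2 * (norm (v - w_star))\<^sup>2 + 2 * \<sigma>\<^sup>2"
      by (simp_all add: integrable_distr_eq integral_distr)
  qed
  have g_first: "integrable ?\<mu> (?g v)" "(\<integral>s. ?g v s \<partial>?\<mu>) = grad F v" for v
    using A2[of v] by (simp_all add: integrable_distr_eq integral_distr)
  have X_rv: "X k \<in> M \<rightarrow>\<^sub>M S" if "k \<ge> 1" for k
    using iid_indep that by (auto simp: indep_vars_def)
  \<comment> \<open>The error of a single step per \<open>\<alpha>\<^sup>2\<close>; it is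
    independent of \<open>K\<close> because \<open>B\<close> bounds the third moments for all runs
    at once.\<close>
  define E where "E = D * (1 + B)"
  have main: "(\<forall>k\<in>{1..K}. integrable M (\<lambda>\<omega>. (norm (grad F (w K k \<omega>)))\<^sup>2)) \<and>
      Min ((\<lambda>k. \<integral>\<omega>. (norm (grad F (w K k \<omega>)))\<^sup>2 \<partial>M) ` {1..K}) \<le> (F w\<^sub>1 - F w_star + E) / sqrt (real K)"
    if K: "K \<ge> 1" for K
  proof -
    define \<alpha> where "\<alpha> = 1 / sqrt (real K)"
    have \<alpha>: "\<alpha> > 0"
      using K by (simp add: \<alpha>_def)
    have iter: "sgd_iterates M f G X (\<lambda>_. \<alpha>) K w\<^sub>1 (w K)"
      using iterates[OF K] by (simp add: \<alpha>_def)
    let ?F = "\<lambda>k. expectation (\<lambda>\<omega>. F (w K k \<omega>))"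
    let ?N = "\<lambda>k. expectation (\<lambda>\<omega>. (norm (grad F (w K k \<omega>)))\<^sup>2)"
    \<comment> \<open>Integrability of \<open>F\<close> is recorded at index \<open>k + 1\<close> so
      that it reaches the last iterate \<open>K + 1\<close>, where the telescoped sum is bounded
      from below.\<close>
    have step: "integrable M (\<lambda>\<omega>. (norm (grad F (w K k \<omega>)))\<^sup>2) \<and>
        integrable M (\<lambda>\<omega>. F (w K (k + 1) \<omega>)) \<and>
        ?F (k + 1) \<le> ?F k - \<alpha> * ?N k + \<alpha>\<^sup>2 * E" if k: "k \<in> {1..K}" for k
    proof -
      have k': "1 \<le> k" "k \<le> K + 1" "k \<in> {1..K + 1}" "k + 1 \<in> {1..K + 1}"
        using k by auto
      have next_w: "w K (Suc k) \<omega> = w K k \<omega> - \<alpha> *\<^sub>R G (?g (w K k \<omega>) (X k \<omega>)) \<alpha>"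
        if "\<omega> \<in> space M" for \<omega>
        using iter k that by (simp add: sgd_iterates_def)
      have w: "w K k \<in> borel_measurable M"
        "distr M borel (w K k) \<Otimes>\<^sub>M distr M S (X k) = distr M (borel \<Otimes>\<^sub>M S) (\<lambda>\<omega>. (w K k \<omega>, X k \<omega>))"
        using sgd_iterate_independent_of_data[OF iid_indep iter f_meas _ _ k'(1,2)] f_diff G_meas[OF \<alpha>]
        by auto
      have moment': "integrable M (\<lambda>\<omega>. norm (w K k \<omega> - \<alpha> *\<^sub>R G (?g (w K k \<omega>) (X k \<omega>)) \<alpha> - w_star) ^ 3)"
        using A6(2)[OF K k'(4)] by (simp add: next_w cong: Bochner_Integration.integrable_cong)
      \<comment> \<open>Once the joint law has been supplied in terms of \<open>X k\<close>, the
        identical distribution rewrites the remaining premises to the law of \<open>\<xi>\<close>,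
        for which the gradient moments are known.\<close>
      note descent = sgd_step_expected_descent[where F = F and g = ?g and G = "\<lambda>x. G x \<alpha>"
          and H = "\<lambda>x. H x \<alpha>", OF w(1) X_rv[OF k'(1)] w(2) A3_F(1,4) less_imp_le[OF A3_F(3)] minimizer
          G_H[OF \<alpha>] A1(3)[OF \<alpha>] A1(4)[OF \<alpha>] A1(2) G_meas[OF \<alpha>] g_meas,
          unfolded iid_distr[OF k'(1)], OF g_first g_second A6(2)[OF K k'(3), THEN conjunct1] moment',
          folded D_def]
      have "?F (k + 1) = expectation (\<lambda>\<omega>. F (w K k \<omega> - \<alpha> *\<^sub>R G (?g (w K k \<omega>) (X k \<omega>)) \<alpha>))"
        by (simp add: next_w cong: Bochner_Integration.integral_cong)
      also have "\<dots> \<le> ?F k - \<alpha> * ?N k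
          + \<alpha>\<^sup>2 * (D * (1 + expectation (\<lambda>\<omega>. norm (w K k \<omega> - w_star) ^ 3)))"
        by (rule descent(3))
      also have "\<dots> \<le> ?F k - \<alpha> * ?N k + \<alpha>\<^sup>2 * E"
        unfolding E_def using A6(2)[OF K k'(3)] \<open>D \<ge> 0\<close>
        by (intro add_left_mono mult_left_mono) auto
      finally show ?thesis
        using descent(1,2) by (simp add: next_w cong: Bochner_Integration.integrable_cong)
    qed
    have "F w_star \<le> ?F (K + 1)"
      using step[of K] K minimizer by (intro integral_ge_const) (auto simp: is_arg_min_linorder)
    then have "\<alpha> * real K * Min (?N ` {1..K}) \<le> ?F 1 - F w_star + real K * (\<alpha>\<^sup>2 * E)"
      using K \<alpha> step by (intro Min_le_telescope) auto
    also have "?F 1 = F w\<^sub>1"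
      using iter by (simp add: sgd_iterates_def prob_space cong: Bochner_Integration.integral_cong)
    also have "\<alpha> * real K = sqrt (real K)"
      using K by (simp add: \<alpha>_def real_div_sqrt)
    \<comment> \<open>The step size balances both sides: the accumulated error stays constant while
      the weight of the minimum grows like \<open>sqrt K\<close>.\<close>
    also have "real K * (\<alpha>\<^sup>2 * E) = E"
      using K by (simp add: \<alpha>_def power_divide)
    finally have "Min (?N ` {1..K}) \<le> (F w\<^sub>1 - F w_star + E) / sqrt (real K)"
      using K by (simp add: pos_le_divide_eq mult.commute)
    then show ?thesis
      using step by blast
  qed
  then show ?thesis
    by blast
qed

end
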